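(* For any graph $G$, the inequality $\alpha_t^{DP}(G)\ge t|V(G)|/\chi_{DP}(G)$ holds for at least half of the values of $t$ in $[\chi_{DP}(G)-1]$.
   Context: All graphs are nonempty, finite and simple. For a nonnegative integer $m$ write $[m]=\{1,\dots,m\}$ (empty if $m=0$); $\mathbb{N}=\{1,2,\dots\}$. For $S,U\subseteq V(H)$, $E_H(S,U)$ is the set of edges of $H$ with at least one endpoint in $S$ and at least one endpoint in $U$. A cover of a graph $G$ is a pair $\mathcal{H}=(L,H)$ where $H$ is a graph and $L:V(G)\to\mathcal{P}(V(H))$ satisfies: (1) the sets $L(u)$, $u\in V(G)$, partition $V(H)$; (2) $H[L(u)]$ is complete for every $u\in V(G)$; (3) for every $uv\in E(G)$, $E_H(L(u),L(v))$ is a (possibly empty) matching; (4) if $u\neq v$ and $uv\notin E(G)$, then $E_H(L(u),L(v))=\emptyset$. The cover is $m$-fold if $|L(u)|=m$ for all $u\in V(G)$. An $\mathcal{H}$-coloring of $G$ is an independent set of size $|V(G)|$ in $H$. The DP-chromatic number $\chi_{DP}(G)$ is the smallest $m$ such that $G$ has an $\mathcal{H}$-coloring for every $m$-fold cover $\mathcal{H}$ of $G$. For $t\in\mathbb{N}$, the partial DP $t$-chromatic number $\alpha_t^{DP}(G)$ is the minimum of $\alpha(H)$ (the independence number of $H$) over all $t$-fold covers $\mathcal{H}=(L,H)$ of $G$. *)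

theory Defs
  imports Complex_Main "HOL-Library.Ramsey" "HOL-Library.Disjoint_Sets"
begin

text \<open>
  A graph is given by its vertex set and its set of edges, the latter being two-element
  sets of vertices. Complete subgraphs and independent sets are \<^const>\<open>clique\<close> and
  \<^const>\<open>indep\<close> from \<^theory>\<open>HOL-Library.Ramsey\<close>.
\<close>

definition simple_graph :: "'a set \<Rightarrow> 'a set set \<Rightarrow> bool" where
  "simple_graph V E \<longleftrightarrow> V \<noteq> {} \<and> finite V \<and> E \<subseteq> [V]\<^bsup>2\<^esup>"

definition edges_between :: "'a set set \<Rightarrow> 'a set \<Rightarrow> 'a set \<Rightarrow> 'a set set" where
  "edges_between F S U = {e \<in> F. e \<inter> S \<noteq> {} \<and> e \<inter> U \<noteq> {}}"

definition matching :: "'a set set \<Rightarrow> bool" where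
  "matching M \<longleftrightarrow> pairwise disjnt M"

definition independence_number :: "'a set \<Rightarrow> 'a set set \<Rightarrow> nat" where
  "independence_number V E = Max (card ` {S. S \<subseteq> V \<and> indep S E})"

text \<open>
  In \<open>dp_cover V E L W F\<close> the covered graph is \<open>(V, E)\<close> and the cover is \<open>(L, (W, F))\<close>.
\<close>

definition dp_cover ::
  "'a set \<Rightarrow> 'a set set \<Rightarrow> ('a \<Rightarrow> 'b set) \<Rightarrow> 'b set \<Rightarrow> 'b set set \<Rightarrow> bool" where
  "dp_cover V E L W F \<longleftrightarrow>
     simple_graph W F \<and>
     (\<Union>u\<in>V. L u) = W \<and> disjoint_family_on L V \<and>
     (\<forall>u\<in>V. clique (L u) F) \<and>
     (\<forall>u\<in>V. \<forall>v\<in>V. {u, v} \<in> E \<longrightarrow> matching (edges_between F (L u) (L v))) \<and>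
     (\<forall>u\<in>V. \<forall>v\<in>V. u \<noteq> v \<and> {u, v} \<notin> E \<longrightarrow> edges_between F (L u) (L v) = {})"

definition fold_cover ::
  "nat \<Rightarrow> 'a set \<Rightarrow> 'a set set \<Rightarrow> ('a \<Rightarrow> 'b set) \<Rightarrow> 'b set \<Rightarrow> 'b set set \<Rightarrow> bool" where
  "fold_cover m V E L W F \<longleftrightarrow> dp_cover V E L W F \<and> (\<forall>u\<in>V. card (L u) = m)"

definition cover_coloring :: "'a set \<Rightarrow> 'b set \<Rightarrow> 'b set set \<Rightarrow> 'b set \<Rightarrow> bool" where
  "cover_coloring V W F S \<longleftrightarrow> S \<subseteq> W \<and> indep S F \<and> card S = card V"

text \<open>
  Cover graphs are finite, so it is no restriction to take their vertices to be natural
  numbers; see \<open>fold_cover_nat\<close> below. The condition \<open>1 \<le> m\<close> is needed because a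
  \<open>0\<close>-fold cover would have an empty cover graph.
\<close>

definition dp_chromatic_number :: "'a set \<Rightarrow> 'a set set \<Rightarrow> nat" where
  "dp_chromatic_number V E =
     (LEAST m. 1 \<le> m \<and>
        (\<forall>(L :: 'a \<Rightarrow> nat set) W F. fold_cover m V E L W F \<longrightarrow> (\<exists>S. cover_coloring V W F S)))"

definition partial_dp_chromatic_number :: "nat \<Rightarrow> 'a set \<Rightarrow> 'a set set \<Rightarrow> nat" where
  "partial_dp_chromatic_number t V E =
     (LEAST k. \<exists>(L :: 'a \<Rightarrow> nat set) W F. fold_cover t V E L W F \<and> k = independence_number W F)"

lemma indep_image:
  assumes "inj_on f W" "F \<subseteq> [W]\<^bsup>2\<^esup>" "S \<subseteq> W"
  shows "indep (f ` S) ((`) f ` F) \<longleftrightarrow> indep S F"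
proof -
  have *: "f ` {x, y} \<in> (`) f ` F \<longleftrightarrow> {x, y} \<in> F" if "x \<in> S" "y \<in> S" for x y
  proof -
    have "d = {x, y}" if "d \<in> F" "f ` {x, y} = f ` d" for d
    proof -
      have "d \<subseteq> W" "{x, y} \<subseteq> W"
        using assms that \<open>x \<in> S\<close> \<open>y \<in> S\<close> by (auto simp: nsets_def)
      with that(2) show ?thesis
        using inj_on_image_eq_iff[OF assms(1)] by blast
    qed
    then show ?thesis by blast
  qed
  have "f x = f y \<longleftrightarrow> x = y" if "x \<in> S" "y \<in> S" for x y
    using inj_on_eq_iff[OF assms(1)] assms(3) that by blast
  with * show ?thesis
    by (auto simp: indep_def)
qed

lemma fold_cover_nat:
  fixes L :: "'a \<Rightarrow> 'b set"
  assumes "fold_cover m V E L W F"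
  shows "\<exists>(L' :: 'a \<Rightarrow> nat set) W' F'. fold_cover m V E L' W' F' \<and>
           independence_number W' F' = independence_number W F \<and>
           ((\<exists>S. cover_coloring V W' F' S) \<longleftrightarrow> (\<exists>S. cover_coloring V W F S))"
proof -
  have W: "finite W" "W \<noteq> {}" "F \<subseteq> [W]\<^bsup>2\<^esup>" and UN: "(\<Union>u\<in>V. L u) = W"
    and dis: "disjoint_family_on L V" and cl: "\<forall>u\<in>V. clique (L u) F"
    and mt: "\<forall>u\<in>V. \<forall>v\<in>V. {u, v} \<in> E \<longrightarrow> matching (edges_between F (L u) (L v))"
    and em: "\<forall>u\<in>V. \<forall>v\<in>V. u \<noteq> v \<and> {u, v} \<notin> E \<longrightarrow> edges_between F (L u) (L v) = {}"
    and cd: "\<forall>u\<in>V. card (L u) = m"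
    using assms by (auto simp: fold_cover_def dp_cover_def simple_graph_def)
  obtain f :: "'b \<Rightarrow> nat" where f: "inj_on f W"
    using finite_imp_inj_to_nat_seg[OF W(1)] by blast
  have LW: "L u \<subseteq> W" if "u \<in> V" for u
    using UN that by blast
  have FW: "e \<subseteq> W" if "e \<in> F" for e
    using W(3) that by (auto simp: nsets_def)
  let ?W = "f ` W" and ?F = "(`) f ` F" and ?L = "\<lambda>u. f ` L u"
  have inter: "f ` A \<inter> f ` B = f ` (A \<inter> B)" if "A \<subseteq> W" "B \<subseteq> W" for A B
    using inj_on_image_Int[OF f that] by simp
  have eb: "edges_between ?F (?L u) (?L v) = (`) f ` edges_between F (L u) (L v)"
    if "u \<in> V" "v \<in> V" for u v
  proof -
    have "f ` e \<inter> f ` L z = {} \<longleftrightarrow> e \<inter> L z = {}" if "e \<in> F" "z \<in> V" for e z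
      using inter[OF FW[OF that(1)] LW[OF that(2)]] by simp
    then have "{e \<in> F. f ` e \<inter> ?L u \<noteq> {} \<and> f ` e \<inter> ?L v \<noteq> {}} = edges_between F (L u) (L v)"
      using that by (auto simp: edges_between_def simp del: image_is_empty)
    moreover have "{d \<in> ?F. d \<inter> ?L u \<noteq> {} \<and> d \<inter> ?L v \<noteq> {}}
        = (`) f ` {e \<in> F. f ` e \<inter> ?L u \<noteq> {} \<and> f ` e \<inter> ?L v \<noteq> {}}"
      by (rule Compr_image_eq)
    ultimately show ?thesis
      unfolding edges_between_def by (simp only:)
  qed
  have "simple_graph ?W ?F"
    unfolding simple_graph_def
  proof (intro conjI subsetI)
    fix e assume "e \<in> ?F"
    then obtain d where d: "d \<in> F" "e = f ` d" by blast
    have "d \<subseteq> W" "finite d" "card d = 2"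
      using d W(3) by (auto simp: nsets_def)
    moreover from this have "card (f ` d) = 2"
      using card_image[OF inj_on_subset[OF f]] by metis
    ultimately show "e \<in> [?W]\<^bsup>2\<^esup>"
      using d by (auto simp: nsets_def)
  qed (use W in auto)
  moreover have "(\<Union>u\<in>V. ?L u) = ?W"
    using UN by blast
  moreover have "disjoint_family_on ?L V"
    using dis LW by (simp add: disjoint_family_on_def inter)
  moreover have "clique (?L u) ?F" if "u \<in> V" for u
    unfolding clique_def
  proof (intro ballI impI)
    fix x y assume "x \<in> f ` L u" "y \<in> f ` L u" "x \<noteq> y"
    then obtain a b where ab: "a \<in> L u" "b \<in> L u" "a \<noteq> b" "x = f a" "y = f b" by blast
    then have "{a, b} \<in> F" using cl that by (auto simp: clique_def)
    then have "f ` {a, b} \<in> ?F" by (rule imageI)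
    with ab show "{x, y} \<in> ?F" by simp
  qed
  moreover have "matching (edges_between ?F (?L u) (?L v))"
    if uv: "u \<in> V" "v \<in> V" "{u, v} \<in> E" for u v
    unfolding eb[OF uv(1,2)] matching_def
  proof (rule pairwiseI)
    fix x y
    assume "x \<in> (`) f ` edges_between F (L u) (L v)" "y \<in> (`) f ` edges_between F (L u) (L v)"
      and "x \<noteq> y"
    then obtain d e where de: "d \<in> edges_between F (L u) (L v)" "e \<in> edges_between F (L u) (L v)"
      "d \<noteq> e" "x = f ` d" "y = f ` e" by blast
    then have "disjnt d e"
      using mt uv by (auto simp: matching_def pairwise_def)
    moreover have "d \<subseteq> W" "e \<subseteq> W"
      using de FW by (auto simp: edges_between_def)
    ultimately show "disjnt x y"
      using de inter[of d e] by (simp add: disjnt_def)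
  qed
  moreover have "edges_between ?F (?L u) (?L v) = {}"
    if "u \<in> V" "v \<in> V" "u \<noteq> v" "{u, v} \<notin> E" for u v
    using em that eb by simp
  moreover have "card (?L u) = m" if "u \<in> V" for u
    using cd that card_image[OF inj_on_subset[OF f LW[OF that]]] by simp
  ultimately have 1: "fold_cover m V E ?L ?W ?F"
    unfolding fold_cover_def dp_cover_def by (intro conjI ballI impI) (assumption | (elim conjE, assumption) | simp only:)+
  have sets: "{S. S \<subseteq> ?W \<and> indep S ?F} = (`) f ` {S. S \<subseteq> W \<and> indep S F}"
  proof (intro set_eqI iffI)
    fix T assume T: "T \<in> {S. S \<subseteq> ?W \<and> indep S ?F}"
    then obtain S where S: "S \<subseteq> W" "T = f ` S"
      by (auto elim: subset_imageE)
    with T indep_image[OF f W(3) S(1)] show "T \<in> (`) f ` {S. S \<subseteq> W \<and> indep S F}"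
      by simp
  next
    fix T assume "T \<in> (`) f ` {S. S \<subseteq> W \<and> indep S F}"
    then obtain S where S: "S \<subseteq> W" "indep S F" "T = f ` S"
      by auto
    with indep_image[OF f W(3) S(1)] show "T \<in> {S. S \<subseteq> ?W \<and> indep S ?F}"
      by auto
  qed
  have "card (f ` S) = card S" if "S \<subseteq> W" for S
    using card_image[OF inj_on_subset[OF f that]] .
  then have cards: "card ` {S. S \<subseteq> ?W \<and> indep S ?F} = card ` {S. S \<subseteq> W \<and> indep S F}"
    unfolding sets image_image by (intro image_cong) auto
  have "independence_number ?W ?F = independence_number W F"
    unfolding independence_number_def cards ..
  moreover have "(\<exists>S. cover_coloring V X G S) \<longleftrightarrow> card V \<in> card ` {S. S \<subseteq> X \<and> indep S G}"
    for X :: "nat set" and G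
    unfolding cover_coloring_def image_iff by auto
  moreover have "(\<exists>S. cover_coloring V W F S) \<longleftrightarrow> card V \<in> card ` {S. S \<subseteq> W \<and> indep S F}"
    unfolding cover_coloring_def image_iff by auto
  ultimately have "independence_number ?W ?F = independence_number W F \<and>
      ((\<exists>S. cover_coloring V ?W ?F S) \<longleftrightarrow> (\<exists>S. cover_coloring V W F S))"
    by (simp only: cards)
  with 1 show ?thesis
    by (intro exI conjI) (assumption | elim conjE, assumption)+
qed

end

theory Submission
  imports Defs
begin

text \<open>
  Write \<open>k\<close> for the DP-chromatic number. A \<open>t\<close>-fold and a \<open>(k - t)\<close>-fold cover of the same graph
  can be put side by side, joining the two lists of each vertex completely, to give a \<open>k\<close>-fold
  cover. Its coloring splits into independent sets of the two parts, so the partial numbers at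
  \<open>t\<close> and \<open>k - t\<close> add up to at least \<open>card V\<close>. Hence the inequality can fail for at most one of
  \<open>t\<close> and \<open>k - t\<close>.
\<close>

section \<open>Edges, independent sets and neighbours across lists\<close>

lemma simple_graph_edge_neq:
  assumes "simple_graph V E" "{u, v} \<in> E"
  shows "u \<noteq> v"
proof
  assume "u = v"
  with assms have "card {v} = 2"
    by (auto simp: simple_graph_def nsets_def)
  then show False by simp
qed

lemma card_le_independence_number:
  assumes "finite W" "S \<subseteq> W" "indep S F"
  shows "card S \<le> independence_number W F"
proof -
  have "finite {S. S \<subseteq> W \<and> indep S F}"
    using assms(1) by simp
  then show ?thesis
    unfolding independence_number_def using assms by (intro Max_ge) auto
qed

text \<open>Distinct edges from \<open>a\<close> into \<open>L v\<close> would share the vertex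
  \<open>a\<close>. Any edge between the two lists forces \<open>{u, v} \<in> E\<close>, and then
  all edges between them form a matching.\<close>

lemma dp_cover_neighbour_unique:
  assumes "dp_cover V E L W F" "u \<in> V" "v \<in> V" "u \<noteq> v" "a \<in> L u" "y \<in> L v" "z \<in> L v"
    and "{a, y} \<in> F" "{a, z} \<in> F"
  shows "y = z"
proof (rule ccontr)
  assume "y \<noteq> z"
  have e: "{a, y} \<in> edges_between F (L u) (L v)" "{a, z} \<in> edges_between F (L u) (L v)"
    using assms by (auto simp: edges_between_def)
  then have "{u, v} \<in> E"
    using assms(1-4) unfolding dp_cover_def by blast
  then have "matching (edges_between F (L u) (L v))"
    using assms(1-3) by (simp add: dp_cover_def)
  moreover have "{a, y} \<noteq> {a, z}"
    using \<open>y \<noteq> z\<close> by (auto simp: doubleton_eq_iff)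
  ultimately have "disjnt {a, y} {a, z}"
    using e unfolding matching_def by (metis pairwiseD)
  then show False
    by (simp add: disjnt_def)
qed

section \<open>Greedy coloring and the DP-chromatic number\<close>

text \<open>
  Greedy choice: each vertex colored so far excludes at most one element of a new list.
\<close>

lemma partial_transversal_exists:
  assumes cov: "dp_cover V E L W F"
    and fin: "finite U" and "U \<subseteq> V" and large: "\<forall>u\<in>U. card U \<le> card (L u)"
  shows "\<exists>f. \<forall>u\<in>U. f u \<in> L u \<and> (\<forall>v\<in>U. u \<noteq> v \<longrightarrow> {f u, f v} \<notin> F)"
  using fin \<open>U \<subseteq> V\<close> large
proof (induction U)
  case empty
  then show ?case by simp
next
  case (insert x U)
  have "\<forall>u\<in>U. card U \<le> card (L u)"
    using insert.prems insert.hyps by auto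
  with insert obtain f
    where f: "\<forall>u\<in>U. f u \<in> L u \<and> (\<forall>v\<in>U. u \<noteq> v \<longrightarrow> {f u, f v} \<notin> F)"
    by auto
  define N where "N u = {y \<in> L x. {f u, y} \<in> F}" for u
  have N: "card (N u) \<le> 1 \<and> finite (N u)" if "u \<in> U" for u
  proof -
    have "u \<noteq> x" "u \<in> V" "x \<in> V" "f u \<in> L u"
      using that insert f by auto
    then have "y = z" if "y \<in> N u" "z \<in> N u" for y z
      using dp_cover_neighbour_unique[OF cov, of u x "f u" y z] that by (auto simp: N_def)
    then have "N u = {} \<or> (\<exists>y. N u = {y})"
      by blast
    then show ?thesis by auto
  qed
  have "card (\<Union>u\<in>U. N u) \<le> (\<Sum>u\<in>U. card (N u))"
    using insert by (intro card_UN_le)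
  also have "\<dots> \<le> (\<Sum>u\<in>U. 1)"
    using N by (intro sum_mono) auto
  \<comment> \<open>Since \<open>x\<close> is not in \<open>U\<close>, the list of \<open>x\<close>
    has at least \<open>card U + 1\<close> elements, one more than the earlier choices can
    exclude.\<close>
  also have "\<dots> < card (L x)"
    using insert by auto
  finally have "card (\<Union>u\<in>U. N u) < card (L x)" .
  moreover have "finite (\<Union>u\<in>U. N u)"
    using insert N by blast
  ultimately have "\<not> L x \<subseteq> (\<Union>u\<in>U. N u)"
    using card_mono by (metis leD)
  then obtain y where y: "y \<in> L x" "\<forall>u\<in>U. {f u, y} \<notin> F"
    by (auto simp: N_def)
  then have "\<forall>u\<in>insert x U. (f(x := y)) u \<in> L u \<and>
      (\<forall>v\<in>insert x U. u \<noteq> v \<longrightarrow> {(f(x := y)) u, (f(x := y)) v} \<notin> F)"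
    using f insert.hyps by (auto simp: insert_commute)
  then show ?case by blast
qed

text \<open>Lists of size \<open>card V\<close> let the greedy choice run through all of
  \<open>V\<close>, and disjointness of the lists makes the chosen elements distinct. Thus the set
  whose least element is the DP-chromatic number is nonempty.\<close>

lemma fold_cover_card_coloring:
  assumes "simple_graph V E" and fc: "fold_cover (card V) V E L W F"
  shows "\<exists>S. cover_coloring V W F S"
proof -
  have cov: "dp_cover V E L W F" and cd: "\<forall>u\<in>V. card (L u) = card V"
    using fc by (auto simp: fold_cover_def)
  then obtain f where f: "\<forall>u\<in>V. f u \<in> L u \<and> (\<forall>v\<in>V. u \<noteq> v \<longrightarrow> {f u, f v} \<notin> F)"
    using partial_transversal_exists[OF cov, of V] assms(1) by (auto simp: simple_graph_def)
  have "f u \<noteq> f v" if "u \<in> V" "v \<in> V" "u \<noteq> v" for u v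
  proof -
    have "L u \<inter> L v = {}"
      using cov that by (simp add: dp_cover_def disjoint_family_on_def)
    then show ?thesis using f that by (metis disjoint_iff)
  qed
  then have "card (f ` V) = card V"
    by (intro card_image inj_onI) blast
  moreover have "f ` V \<subseteq> W"
    using f cov by (auto simp: dp_cover_def)
  moreover have "indep (f ` V) F"
    using f by (auto simp: indep_def)
  ultimately show ?thesis
    by (auto simp: cover_coloring_def)
qed

text \<open>With \<open>card V\<close> as a witness, the least number has its defining property.
  That property speaks of covers on natural numbers; \<open>fold_cover_nat\<close> carries it to any
  type, as is needed for a join of two covers, which lives on a sum type.\<close>

lemma dp_chromatic_number_coloring:
  fixes V :: "'a set" and L :: "'a \<Rightarrow> 'b set"
  assumes "simple_graph V E" "fold_cover (dp_chromatic_number V E) V E L W F"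
  shows "\<exists>S. cover_coloring V W F S"
proof -
  let ?P = "\<lambda>m. 1 \<le> m \<and>
    (\<forall>(L :: 'a \<Rightarrow> nat set) W F. fold_cover m V E L W F \<longrightarrow> (\<exists>S. cover_coloring V W F S))"
  have "1 \<le> card V"
    using assms(1) by (auto simp: simple_graph_def Suc_le_eq card_gt_0_iff)
  then have "?P (card V)"
    using fold_cover_card_coloring[OF assms(1)] by blast
  then have "?P (dp_chromatic_number V E)"
    unfolding dp_chromatic_number_def by (rule LeastI)
  with fold_cover_nat[OF assms(2)] show ?thesis
    by metis
qed

section \<open>Covers attaining the partial DP-chromatic number\<close>

text \<open>The witness is a disjoint union of complete graphs on \<open>t\<close> vertices, one for
  each vertex of \<open>V\<close>; the empty set of edges between two lists is a matching. The bound
  \<open>1 \<le> t\<close> keeps the cover graph nonempty.\<close>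

lemma fold_cover_exists:
  fixes V :: "'a set"
  assumes G: "simple_graph V E" and "1 \<le> t"
  shows "\<exists>(L :: 'a \<Rightarrow> nat set) W F. fold_cover t V E L W F"
proof -
  define L where "L u = {u} \<times> {..<t}" for u :: 'a
  define W where "W = V \<times> {..<t}"
  define F where "F = {e \<in> [W]\<^bsup>2\<^esup>. \<exists>u\<in>V. e \<subseteq> L u}"
  have "simple_graph W F"
    using assms by (auto simp: simple_graph_def W_def F_def lessThan_empty_iff)
  moreover have "(\<Union>u\<in>V. L u) = W" "disjoint_family_on L V"
    by (auto simp: L_def W_def disjoint_family_on_def)
  moreover have "clique (L u) F" if "u \<in> V" for u
    using that by (auto simp: clique_def F_def L_def W_def nsets_def)
  moreover have empty: "edges_between F (L u) (L v) = {}" if "u \<noteq> v" for u v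
  proof -
    have "e \<inter> L u = {} \<or> e \<inter> L v = {}" if "e \<subseteq> L w" for e w
      using that \<open>u \<noteq> v\<close> by (auto simp: L_def)
    then show ?thesis
      by (auto simp: edges_between_def F_def)
  qed
  moreover have "matching (edges_between F (L u) (L v))" if "{u, v} \<in> E" for u v
    using empty[OF simple_graph_edge_neq[OF G that]] by (simp add: matching_def)
  ultimately have "fold_cover t V E L W F"
    by (auto simp: fold_cover_def dp_cover_def L_def)
  from fold_cover_nat[OF this] show ?thesis
    by blast
qed

lemma partial_dp_chromatic_number_attained:
  fixes V :: "'a set"
  assumes "simple_graph V E" "1 \<le> t"
  obtains L :: "'a \<Rightarrow> nat set" and W F where "fold_cover t V E L W F"
    and "independence_number W F = partial_dp_chromatic_number t V E"
proof -
  have "\<exists>k. \<exists>(L :: 'a \<Rightarrow> nat set) W F. fold_cover t V E L W F \<and> k = independence_number W F"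
    using fold_cover_exists[OF assms] by blast
  from LeastI_ex[OF this] that show thesis
    unfolding partial_dp_chromatic_number_def by metis
qed

section \<open>Joining two covers\<close>

lemma matching_image:
  assumes "matching M" "inj f"
  shows "matching ((`) f ` M)"
  unfolding matching_def
proof (rule pairwiseI)
  fix x y
  assume "x \<in> (`) f ` M" "y \<in> (`) f ` M" "x \<noteq> y"
  then obtain d e where de: "d \<in> M" "e \<in> M" "x = f ` d" "y = f ` e" "d \<noteq> e"
    by blast
  then have "d \<inter> e = {}"
    using pairwiseD[OF assms(1)[unfolded matching_def]] by (metis disjnt_def)
  then show "disjnt x y"
    using de assms(2) by (simp add: disjnt_def flip: image_Int)
qed

lemma matching_Un:
  assumes "matching M" "matching N" "\<Union>M \<inter> \<Union>N = {}"
  shows "matching (M \<union> N)"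
  unfolding matching_def
proof (rule pairwiseI)
  fix x y
  assume xy: "x \<in> M \<union> N" "y \<in> M \<union> N" "x \<noteq> y"
  consider "x \<in> M" "y \<in> M" | "x \<in> N" "y \<in> N" | "x \<in> M" "y \<in> N" | "x \<in> N" "y \<in> M"
    using xy by blast
  then show "disjnt x y"
  proof cases
    case 1
    then show ?thesis
      using assms(1) xy(3) by (simp add: matching_def pairwise_def)
  next
    case 2
    then show ?thesis
      using assms(2) xy(3) by (simp add: matching_def pairwise_def)
  qed (use assms(3) in \<open>auto simp: disjnt_def\<close>)
qed

text \<open>Every new edge runs inside a single list, so between different lists only the edges of
  the two parts remain, on disjoint vertex sets, and the matching conditions carry over. The
  inclusion in \<open>F\<close> later makes both traces of an independent set independent.\<close>

lemma fold_cover_join: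
  fixes L1 :: "'a \<Rightarrow> 'b set" and L2 :: "'a \<Rightarrow> 'c set"
  assumes G: "simple_graph V E"
    and c1: "fold_cover s V E L1 W1 F1" and c2: "fold_cover t V E L2 W2 F2"
  obtains L :: "'a \<Rightarrow> ('b + 'c) set" and W F where "fold_cover (s + t) V E L W F"
    and "W = W1 <+> W2" and "(`) Inl ` F1 \<union> (`) Inr ` F2 \<subseteq> F"
proof -
  have W1: "simple_graph W1 F1" "(\<Union>u\<in>V. L1 u) = W1" "disjoint_family_on L1 V"
    and W2: "simple_graph W2 F2" "(\<Union>u\<in>V. L2 u) = W2" "disjoint_family_on L2 V"
    using c1 c2 by (auto simp: fold_cover_def dp_cover_def)
  define L where "L u = L1 u <+> L2 u" for u
  define W where "W = W1 <+> W2"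
  \<comment> \<open>Taking all pairs inside a list supplies the complete connection between the
    copies of \<open>L1 u\<close> and \<open>L2 u\<close>.\<close>
  define C where "C = {e \<in> [W]\<^bsup>2\<^esup>. \<exists>u\<in>V. e \<subseteq> L u}"
  define F where "F = (`) Inl ` F1 \<union> (`) Inr ` F2 \<union> C"
  have UN: "(\<Union>u\<in>V. L u) = W" and dis: "disjoint_family_on L V"
    using W1 W2 by (fastforce simp: L_def W_def disjoint_family_on_def)+
  have "Inl ` e \<in> [W]\<^bsup>2\<^esup>" if "e \<in> F1" for e
    using W1(1) that by (auto simp: simple_graph_def W_def nsets_def card_image)
  moreover have "Inr ` e \<in> [W]\<^bsup>2\<^esup>" if "e \<in> F2" for e
    using W2(1) that by (auto simp: simple_graph_def W_def nsets_def card_image)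
  ultimately have sg: "simple_graph W F"
    using W1(1) W2(1) by (auto simp: simple_graph_def W_def F_def C_def)
  have cl: "clique (L u) F" if "u \<in> V" for u
    using that UN by (auto simp: clique_def F_def C_def nsets_def)
  have eb: "edges_between F (L u) (L v) =
      (`) Inl ` edges_between F1 (L1 u) (L1 v) \<union> (`) Inr ` edges_between F2 (L2 u) (L2 v)"
    if "u \<in> V" "v \<in> V" "u \<noteq> v" for u v
  proof -
    have "edges_between C (L u) (L v) = {}"
    proof -
      \<comment> \<open>By disjointness of the lists, a set inside \<open>L w\<close> misses
        \<open>L v\<close> if \<open>w = u\<close>, and misses \<open>L u\<close> otherwise.\<close>
      have "e \<inter> L u = {} \<or> e \<inter> L v = {}" if "e \<subseteq> L w" "w \<in> V" for e w
      proof (cases "w = u")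
        case True
        then have "L w \<inter> L v = {}"
          using dis \<open>u \<in> V\<close> \<open>v \<in> V\<close> \<open>u \<noteq> v\<close> by (simp add: disjoint_family_on_def)
        then show ?thesis using that by blast
      next
        case False
        then have "L w \<inter> L u = {}"
          using dis \<open>u \<in> V\<close> \<open>w \<in> V\<close> by (simp add: disjoint_family_on_def)
        then show ?thesis using that by blast
      qed
      then show ?thesis by (auto simp: edges_between_def C_def)
    qed
    moreover have "Inl ` e \<inter> L w = {} \<longleftrightarrow> e \<inter> L1 w = {}" "Inr ` d \<inter> L w = {} \<longleftrightarrow> d \<inter> L2 w = {}"
      for d e w
      by (auto simp: L_def)
    then have "edges_between ((`) Inl ` F1) (L u) (L v) = (`) Inl ` edges_between F1 (L1 u) (L1 v)"
      "edges_between ((`) Inr ` F2) (L u) (L v) = (`) Inr ` edges_between F2 (L2 u) (L2 v)"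
      unfolding edges_between_def Compr_image_eq by simp_all
    moreover have "edges_between (A \<union> B) X Y = edges_between A X Y \<union> edges_between B X Y"
      for A B :: "('b + 'c) set set" and X Y
      by (auto simp: edges_between_def)
    ultimately show ?thesis
      unfolding F_def by simp
  qed
  have mt: "matching (edges_between F (L u) (L v))" if "u \<in> V" "v \<in> V" "{u, v} \<in> E" for u v
  proof -
    have "matching (edges_between F1 (L1 u) (L1 v))" "matching (edges_between F2 (L2 u) (L2 v))"
      using c1 c2 that unfolding fold_cover_def dp_cover_def by simp_all
    \<comment> \<open>The images under \<open>Inl\<close> and \<open>Inr\<close> share no vertex, so
      the union of the two matchings is a matching.\<close>
    then show ?thesis
      unfolding eb[OF that(1,2) simple_graph_edge_neq[OF G that(3)]]
      by (intro matching_Un matching_image) auto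
  qed
  have em: "edges_between F (L u) (L v) = {}" if "u \<in> V" "v \<in> V" "u \<noteq> v" "{u, v} \<notin> E" for u v
  proof -
    have "edges_between F1 (L1 u) (L1 v) = {}" "edges_between F2 (L2 u) (L2 v) = {}"
      using c1 c2 that unfolding fold_cover_def dp_cover_def by simp_all
    then show ?thesis
      unfolding eb[OF that(1-3)] by simp
  qed
  have "dp_cover V E L W F"
    unfolding dp_cover_def
    by (intro conjI ballI impI) (use sg UN dis cl mt em in simp_all)
  moreover have "card (L u) = s + t" if "u \<in> V" for u
  proof -
    have "finite (L1 u)" "finite (L2 u)"
      using W1 W2 that by (auto simp: simple_graph_def intro: finite_subset)
    then show ?thesis
      using c1 c2 that by (simp add: L_def card_Plus fold_cover_def)
  qed
  ultimately show thesis
    using that[of L W F] by (auto simp: fold_cover_def W_def F_def)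
qed

section \<open>Complementary fold numbers and the final count\<close>

lemma card_le_partial_dp_chromatic_number_add:
  assumes G: "simple_graph V E" and "1 \<le> s" "1 \<le> t" and k: "s + t = dp_chromatic_number V E"
  shows "card V \<le> partial_dp_chromatic_number s V E + partial_dp_chromatic_number t V E"
proof -
  obtain L1 :: "'a \<Rightarrow> nat set" and W1 F1 where c1: "fold_cover s V E L1 W1 F1"
    and i1: "independence_number W1 F1 = partial_dp_chromatic_number s V E"
    using partial_dp_chromatic_number_attained[OF G \<open>1 \<le> s\<close>] .
  obtain L2 :: "'a \<Rightarrow> nat set" and W2 F2 where c2: "fold_cover t V E L2 W2 F2"
    and i2: "independence_number W2 F2 = partial_dp_chromatic_number t V E"
    using partial_dp_chromatic_number_attained[OF G \<open>1 \<le> t\<close>] .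
  have fin: "finite W1" "finite W2"
    using c1 c2 by (auto simp: fold_cover_def dp_cover_def simple_graph_def)
  obtain L :: "'a \<Rightarrow> (nat + nat) set" and W F where c: "fold_cover (s + t) V E L W F"
    and W: "W = W1 <+> W2" and F: "(`) Inl ` F1 \<union> (`) Inr ` F2 \<subseteq> F"
    using fold_cover_join[OF G c1 c2] .
  obtain S where S: "S \<subseteq> W" "indep S F" "card S = card V"
    using dp_chromatic_number_coloring[OF G c[unfolded k]] by (auto simp: cover_coloring_def)
  have sub: "Inl -` S \<subseteq> W1" "Inr -` S \<subseteq> W2"
    using S(1) W by auto
  \<comment> \<open>An edge of \<open>F1\<close> inside the preimage of \<open>S\<close> would give
    an edge of \<open>F\<close> inside \<open>S\<close>.\<close>
  have "{Inl x, Inl y} \<in> F" if "{x, y} \<in> F1" for x y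
    using imageI[OF that, of "(`) Inl"] F by (auto simp: subset_iff)
  then have "indep (Inl -` S) F1"
    using S(2) by (fastforce simp: indep_def)
  moreover have "{Inr x, Inr y} \<in> F" if "{x, y} \<in> F2" for x y
    using imageI[OF that, of "(`) Inr"] F by (auto simp: subset_iff)
  then have "indep (Inr -` S) F2"
    using S(2) by (fastforce simp: indep_def)
  ultimately have "card (Inl -` S) \<le> partial_dp_chromatic_number s V E"
    "card (Inr -` S) \<le> partial_dp_chromatic_number t V E"
    using card_le_independence_number fin sub i1 i2 by metis+
  moreover have "S = (Inl -` S) <+> (Inr -` S)"
  proof (rule set_eqI)
    show "x \<in> S \<longleftrightarrow> x \<in> (Inl -` S) <+> (Inr -` S)" for x
      by (cases x) auto
  qed
  then have "card S = card (Inl -` S) + card (Inr -` S)"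
    using card_Plus fin sub finite_subset by metis
  ultimately show ?thesis
    using S(3) by simp
qed

text \<open>The reflection \<open>t \<mapsto> k - t\<close> sends failures injectively to successes.
  A fixed point of it satisfies \<open>P\<close> by the assumption.\<close>

lemma card_ge_half_if_reflection:
  fixes k :: nat
  assumes "\<And>t. t \<in> {1..k - 1} \<Longrightarrow> P t \<or> P (k - t)"
  shows "real (card {t \<in> {1..k - 1}. P t}) \<ge> real (card {1..k - 1}) / 2"
proof -
  let ?A = "{t \<in> {1..k - 1}. P t}" and ?B = "{t \<in> {1..k - 1}. \<not> P t}"
  \<comment> \<open>All \<open>t\<close> here are below \<open>k\<close>, so the truncated
    subtraction loses nothing.\<close>
  have "inj_on (\<lambda>t. k - t) ?B"
    by (intro inj_onI) auto
  moreover have "(\<lambda>t. k - t) ` ?B \<subseteq> ?A"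
    using assms by auto
  ultimately have "card ?B \<le> card ?A"
    by (intro card_inj_on_le) auto
  moreover have "card (?A \<union> ?B) = card ?A + card ?B"
    by (intro card_Un_disjoint) auto
  moreover have "?A \<union> ?B = {1..k - 1}"
    by auto
  ultimately show ?thesis by simp
qed

theorem theorem8:
  fixes V :: "'a set" and E :: "'a set set"
  assumes "simple_graph V E"
  shows "real (card {t \<in> {1..dp_chromatic_number V E - 1}.
            real (partial_dp_chromatic_number t V E)
              \<ge> real t * real (card V) / real (dp_chromatic_number V E)})
         \<ge> real (card {1..dp_chromatic_number V E - 1}) / 2"
proof (rule card_ge_half_if_reflection)
  fix t
  let ?k = "dp_chromatic_number V E" and ?n = "real (card V)"
  let ?a = "\<lambda>t. real (partial_dp_chromatic_number t V E)"
  assume t: "t \<in> {1..?k - 1}"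
  then have "card V \<le> partial_dp_chromatic_number t V E + partial_dp_chromatic_number (?k - t) V E"
    using assms by (intro card_le_partial_dp_chromatic_number_add) auto
  then have "?n \<le> ?a t + ?a (?k - t)"
    by linarith
  moreover have "real t * ?n / real ?k + real (?k - t) * ?n / real ?k = ?n"
  proof -
    have "0 < ?k" "real t + real (?k - t) = real ?k"
      using t by auto
    then show ?thesis
      by (metis add_divide_distrib distrib_right nonzero_mult_div_cancel_left of_nat_0_less_iff
          less_irrefl)
  qed
  \<comment> \<open>The two thresholds sum to \<open>?n\<close>; if both inequalities failed, the
    two partial numbers would sum to less than \<open>?n\<close>.\<close>
  ultimately show "real t * ?n / real ?k \<le> ?a t \<or> real (?k - t) * ?n / real ?k \<le> ?a (?k - t)"
    by linarith
qed

end
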